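(* Assume the setting and hypotheses listed in the context. Then the solution $y$ of the impulsive system $$ \begin{cases} y'(t)=A(t)y(t)+B(t)y(\gamma(t))+F(t), & t\neq t_k,\\ y(t_k)=(I+C_k)\,y(t_k^-)+D_k, & t=t_k,\\ y_0=y(\tau) \end{cases} $$ is given by the variation of parameters formula $$ \begin{aligned} y(t)={}&W(t,\tau)y(\tau)+\int_{\tau}^{\zeta_{k(\tau)}}W(t,\tau)\Phi(\tau,s)F(s)\,ds+\sum_{r=k(\tau)+1}^{k(t)}\int_{t_r}^{\zeta_r}W(t,t_r)\Phi(t_r,s)F(s)\,ds\\ &+\sum_{r=k(\tau)}^{k(t)-1}\int_{\zeta_r}^{t_{r+1}}W(t,t_{r+1})(I+C_{r+1})\Phi(t_{r+1},s)F(s)\,ds+\int_{\zeta_{k(t)}}^{t}\Phi(t,s)F(s)\,ds+\sum_{r=k(\tau)+1}^{k(t)}W(t,t_r)D_r , \end{aligned} $$ for $t\in[\tau,t_{k(t)+1})$, where $W$ is the fundamental matrix (defined explicitly in the context) of the homogeneous impulsive system $w'(t)=A(t)w(t)+B(t)w(\gamma(t))$ for $t\ne t_k$, $w(t_k)=(I+C_k)w(t_k^-)$.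
   Context: **Piecewise constant argument of generalized type.** $(t_k)_{k\in\mathbb{Z}}$ and $(\zeta_k)_{k\in\mathbb{Z}}$ are real sequences with $t_k<t_{k+1}$ for all $k$, $t_k\to\infty$ as $k\to\infty$, $t_k\to-\infty$ as $k\to-\infty$, and $\zeta_k\in[t_k,t_{k+1}]$. Put $I_k=[t_k,t_{k+1})$ and $\gamma(t)=\zeta_k$ for $t\in I_k$. For $t\in\mathbb{R}$, $k(t)$ denotes the unique integer $k$ with $t\in I_k$. **Data.** $\tau\in\mathbb{R}$ is the initial time and $y_0\in\mathbb{R}^n$ the initial value. $A(t),B(t)\in\mathbb{R}^{n\times n}$ are real-valued, continuous and locally integrable; $F(t)\in\mathbb{R}^{n}$ is real-valued and continuous; $C_k\in\mathbb{R}^{n\times n}$ with $I+C_k$ invertible for all $k\in\mathbb{Z}$; $D_k\in\mathbb{R}^n$. $I$ is the $n\times n$ identity matrix, and $y(t_k^-)$ denotes the left-hand limit of $y$ at $t_k$. **Convention at the initial time.** One assumes $\gamma(\tau):=\tau$ if $\gamma(\tau)<\tau$; correspondingly $\zeta_{k(\tau)}$ is read as $\gamma(\tau)$ for the problem started at $\tau$. **Solution.** A solution is a piecewise continuous function $y$ that is continuous on the intervals $I_k=[t_k,t_{k+1})$ with first kind discontinuities at the $t_k$; whose derivative $y'(t)$ exists at each $t$ with the possible exception of the times $t_k$, where lateral derivatives exist; which satisfies the ordinary differential equation $y'(t)=A(t)y(t)+B(t)y(\zeta_k)+F(t)$ on every interval $I_k$; and which satisfies the impulsive condition $y(t_k)=(I+C_k)y(t_k^-)+D_k$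 at $t=t_k$. For the initial value problem these requirements are considered from $\tau$ onwards, with $y(\tau)=y_0$. **Matrices.** $\Phi(t,s)$ is the transition (Cauchy) matrix of $x'(t)=A(t)x(t)$, with $\Phi(t,t)=I$. Define $$J(t,s)=I+\int_s^t\Phi(s,u)B(u)\,du,\qquad E(t,s)=\Phi(t,s)J(t,s).$$ **Hypotheses.** Let $\|\cdot\|$ be some matrix norm. For $M\in\{A,B\}$ let $$\rho_k^{+}(M)=\exp\Big(\int_{t_k}^{\zeta_k}\|M(u)\|du\Big),\quad \rho_k^{-}(M)=\exp\Big(\int_{\zeta_k}^{t_{k+1}}\|M(u)\|du\Big),\quad \rho_k(M)=\rho_k^+(M)\rho_k^-(M),$$ $$\nu_k^{\pm}(B)=\rho_k^{\pm}(A)\,\ln\rho_k^{\pm}(B).$$ Assume $\rho(A)=\sup_{k\in\mathbb{Z}}\rho_k(A)<\infty$, $\nu^{\pm}(B)=\sup_{k\in\mathbb{Z}}\nu_k^{\pm}(B)<\infty$, and $\nu_k^{\pm}(B)\le\nu^{\pm}(B)<1$. As a consequence, $J(t_k,\zeta_k)$ and $J(t_{k+1},\zeta_k)$ are invertible for all $k\in\mathbb{Z}$. In addition, it is assumed that $J^{-1}(\tau,\gamma(\tau))$ exists. **Fundamental matrix $W$.** If $t,s\in I_k$ for the same $k$, then $$W(t,s)=E(t,\gamma(s))\,E^{-1}(s,\gamma(s)).$$ If $t\in I_{k(t)}$ and $s\in I_{k(s)}$ with $k(t)>k(s)$, then $$W(t,s)=E(t,\zeta_{k(t)})E^{-1}(t_{k(t)},\zeta_{k(t)})\Big({}^{\leftarrow}\!\!\prod_{j=k(s)+1}^{k(t)-1}(I+C_{j+1})E(t_{j+1},\zeta_j)E^{-1}(t_j,\zeta_j)\Big)(I+C_{k(s)+1})E(t_{k(s)+1},\gamma(s))E^{-1}(s,\gamma(s)).$$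 It is used with $s=\tau$ and $s=t_r$, $r\ge k(\tau)+1$. Here ${}^{\leftarrow}\prod_{j=a}^{b}T_j=T_bT_{b-1}\cdots T_a$; empty products equal the identity and empty sums equal $0$.
   Formalization: When ζ_k = t_{k+1}, the value y(ζ_k) in the equation on I_k is read as the left-hand limit y(t_{k+1}^-) instead of the post-jump value y(t_{k+1}), for which the formula fails. *)

theory Defs
  imports "HOL-Analysis.Analysis"
begin

text \<open>
  Time is \<open>real\<close>, vectors live in \<open>real^'n\<close>, matrices in \<open>real^'n^'n\<close>.  The sequences
  $(t_k)$ and $(\zeta_k)$ are functions \<open>tk \<zeta> :: int \<Rightarrow> real\<close>.  All integrals are the
  oriented ones: \<open>LBINT u=a..b. f u\<close> is minus the integral over \<open>[b, a]\<close> when \<open>b < a\<close>.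
\<close>

text \<open>A matrix norm is a norm on the space of square matrices that is submultiplicative;
  it need not be induced by a vector norm, and the identity need not have norm 1.\<close>

definition matrix_norm :: "(real^'n^'n \<Rightarrow> real) \<Rightarrow> bool" where
  "matrix_norm N \<longleftrightarrow>
     (\<forall>X. 0 \<le> N X) \<and> (\<forall>X. N X = 0 \<longleftrightarrow> X = 0) \<and>
     (\<forall>c X. N (c *\<^sub>R X) = \<bar>c\<bar> * N X) \<and>
     (\<forall>X Y. N (X + Y) \<le> N X + N Y) \<and>
     (\<forall>X Y. N (X ** Y) \<le> N X * N Y)"

definition transition_matrix ::
    "(real \<Rightarrow> real^'n^'n) \<Rightarrow> (real \<Rightarrow> real \<Rightarrow> real^'n^'n) \<Rightarrow> bool" where
  "transition_matrix A \<Phi> \<longleftrightarrow>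
     (\<forall>s. \<Phi> s s = mat 1) \<and>
     (\<forall>s t. ((\<lambda>x. \<Phi> x s) has_vector_derivative (A t ** \<Phi> t s)) (at t))"

definition interval_index :: "(int \<Rightarrow> real) \<Rightarrow> real \<Rightarrow> int" where
  "interval_index tk t = (THE k. tk k \<le> t \<and> t < tk (k + 1))"

text \<open>The sequence $\zeta$ as read for the problem started at \<open>\<tau>\<close>: if
  $\gamma(\tau) < \tau$ then $\gamma(\tau) := \tau$, i.e. $\zeta_{k(\tau)}$ is replaced by \<open>\<tau>\<close>.\<close>

definition zeta_from :: "(int \<Rightarrow> real) \<Rightarrow> (int \<Rightarrow> real) \<Rightarrow> real \<Rightarrow> int \<Rightarrow> real" where
  "zeta_from tk \<zeta> \<tau> k =
     (if k = interval_index tk \<tau> \<and> \<zeta> k < \<tau> then \<tau> else \<zeta> k)"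

definition pc_arg :: "(int \<Rightarrow> real) \<Rightarrow> (int \<Rightarrow> real) \<Rightarrow> real \<Rightarrow> real" where
  "pc_arg tk \<zeta> t = \<zeta> (interval_index tk t)"

definition left_limit :: "(real \<Rightarrow> real^'n) \<Rightarrow> real \<Rightarrow> real^'n" where
  "left_limit y t = Lim (at_left t) y"

text \<open>The value $y(\zeta_k)$ in the equation on $I_k = [t_k, t_{k+1})$.  In the boundary case
  $\zeta_k = t_{k+1}$ the point $\zeta_k$ lies outside $I_k$ and \<open>y\<close> may jump there; the value
  meant is that of the continuous extension of \<open>y\<close> from $I_k$, i.e. $y(t_{k+1}^-)$.  With the value
  after the jump, neither the fundamental matrix below would solve the homogeneous
  system nor would the variation of parameters formula hold.\<close>

definition arg_value ::
    "(int \<Rightarrow> real) \<Rightarrow> (int \<Rightarrow> real) \<Rightarrow> (real \<Rightarrow> real^'n) \<Rightarrow> int \<Rightarrow> real^'n" where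
  "arg_value tk \<zeta> y k =
     (if \<zeta> k < tk (k + 1) then y (\<zeta> k) else left_limit y (tk (k + 1)))"

text \<open>Solutions of the initial value problem, considered on \<open>[\<tau>, \<infinity>)\<close>.  The derivative within
  \<open>{max \<tau> (tk k)..<tk (k + 1)}\<close> is the ordinary one at interior points and the right-hand one at
  the left end point.  The left-hand derivative at a jump time is that of the continuous
  extension from the left, hence the difference quotient with the left-hand limit.  No impulse
  acts at \<open>\<tau>\<close> itself, even if \<open>\<tau>\<close> is one of the $t_k$.\<close>

definition ivp_solution ::
    "(int \<Rightarrow> real) \<Rightarrow> (int \<Rightarrow> real) \<Rightarrow> (real \<Rightarrow> real^'n^'n) \<Rightarrow> (real \<Rightarrow> real^'n^'n) \<Rightarrow>
     (real \<Rightarrow> real^'n) \<Rightarrow> (int \<Rightarrow> real^'n^'n) \<Rightarrow> (int \<Rightarrow> real^'n) \<Rightarrow>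
     real \<Rightarrow> real^'n \<Rightarrow> (real \<Rightarrow> real^'n) \<Rightarrow> bool" where
  "ivp_solution tk \<zeta> A B F C D \<tau> y0 y \<longleftrightarrow>
     (\<forall>k\<ge>interval_index tk \<tau>.
        continuous_on {max \<tau> (tk k)..<tk (k + 1)} y \<and>
        (\<forall>t\<in>{max \<tau> (tk k)..<tk (k + 1)}.
           (y has_vector_derivative (A t *v y t + B t *v arg_value tk \<zeta> y k + F t))
             (at t within {max \<tau> (tk k)..<tk (k + 1)}))) \<and>
     (\<forall>k>interval_index tk \<tau>.
        (\<exists>l. (y \<longlongrightarrow> l) (at_left (tk k))) \<and>
        (\<exists>d. ((\<lambda>t. (y t - left_limit y (tk k)) /\<^sub>R (t - tk k)) \<longlongrightarrow> d) (at_left (tk k))) \<and>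
        y (tk k) = (mat 1 + C k) *v left_limit y (tk k) + D k) \<and>
     y \<tau> = y0"

definition J_mat ::
    "(real \<Rightarrow> real \<Rightarrow> real^'n^'n) \<Rightarrow> (real \<Rightarrow> real^'n^'n) \<Rightarrow> real \<Rightarrow> real \<Rightarrow> real^'n^'n" where
  "J_mat \<Phi> B t s = mat 1 + (LBINT u=s..t. \<Phi> s u ** B u)"

definition E_mat ::
    "(real \<Rightarrow> real \<Rightarrow> real^'n^'n) \<Rightarrow> (real \<Rightarrow> real^'n^'n) \<Rightarrow> real \<Rightarrow> real \<Rightarrow> real^'n^'n" where
  "E_mat \<Phi> B t s = \<Phi> t s ** J_mat \<Phi> B t s"

definition rho_plus ::
    "(real^'n^'n \<Rightarrow> real) \<Rightarrow> (int \<Rightarrow> real) \<Rightarrow> (int \<Rightarrow> real) \<Rightarrow> (real \<Rightarrow> real^'n^'n) \<Rightarrow> int \<Rightarrow> real" where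
  "rho_plus N tk \<zeta> M k = exp (LBINT u=tk k..\<zeta> k. N (M u))"

definition rho_minus ::
    "(real^'n^'n \<Rightarrow> real) \<Rightarrow> (int \<Rightarrow> real) \<Rightarrow> (int \<Rightarrow> real) \<Rightarrow> (real \<Rightarrow> real^'n^'n) \<Rightarrow> int \<Rightarrow> real" where
  "rho_minus N tk \<zeta> M k = exp (LBINT u=\<zeta> k..tk (k + 1). N (M u))"

definition rho ::
    "(real^'n^'n \<Rightarrow> real) \<Rightarrow> (int \<Rightarrow> real) \<Rightarrow> (int \<Rightarrow> real) \<Rightarrow> (real \<Rightarrow> real^'n^'n) \<Rightarrow> int \<Rightarrow> real" where
  "rho N tk \<zeta> M k = rho_plus N tk \<zeta> M k * rho_minus N tk \<zeta> M k"

definition nu_plus ::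
    "(real^'n^'n \<Rightarrow> real) \<Rightarrow> (int \<Rightarrow> real) \<Rightarrow> (int \<Rightarrow> real) \<Rightarrow> (real \<Rightarrow> real^'n^'n) \<Rightarrow>
     (real \<Rightarrow> real^'n^'n) \<Rightarrow> int \<Rightarrow> real" where
  "nu_plus N tk \<zeta> A B k = rho_plus N tk \<zeta> A k * ln (rho_plus N tk \<zeta> B k)"

definition nu_minus ::
    "(real^'n^'n \<Rightarrow> real) \<Rightarrow> (int \<Rightarrow> real) \<Rightarrow> (int \<Rightarrow> real) \<Rightarrow> (real \<Rightarrow> real^'n^'n) \<Rightarrow>
     (real \<Rightarrow> real^'n^'n) \<Rightarrow> int \<Rightarrow> real" where
  "nu_minus N tk \<zeta> A B k = rho_minus N tk \<zeta> A k * ln (rho_minus N tk \<zeta> B k)"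

text \<open>The product $T_b T_{b-1} \cdots T_a$, equal to the identity if \<open>b < a\<close>.\<close>

definition left_prod :: "(int \<Rightarrow> real^'n^'n) \<Rightarrow> int \<Rightarrow> int \<Rightarrow> real^'n^'n" where
  "left_prod T a b = fold (\<lambda>j P. T j ** P) [a..b] (mat 1)"

text \<open>The fundamental matrix $W(t,s)$; it is only meaningful when $k(s) \le k(t)$.\<close>

definition W_mat ::
    "(int \<Rightarrow> real) \<Rightarrow> (int \<Rightarrow> real) \<Rightarrow> (real \<Rightarrow> real \<Rightarrow> real^'n^'n) \<Rightarrow> (real \<Rightarrow> real^'n^'n) \<Rightarrow>
     (int \<Rightarrow> real^'n^'n) \<Rightarrow> real \<Rightarrow> real \<Rightarrow> real^'n^'n" where
  "W_mat tk \<zeta> \<Phi> B C t s =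
     (let kt = interval_index tk t; ks = interval_index tk s; \<gamma> = pc_arg tk \<zeta>; E = E_mat \<Phi> B in
      if kt = ks then E t (\<gamma> s) ** matrix_inv (E s (\<gamma> s))
      else E t (\<zeta> kt) ** matrix_inv (E (tk kt) (\<zeta> kt))
           ** left_prod (\<lambda>j. (mat 1 + C (j + 1)) ** E (tk (j + 1)) (\<zeta> j)
                              ** matrix_inv (E (tk j) (\<zeta> j))) (ks + 1) (kt - 1)
           ** (mat 1 + C (ks + 1)) ** E (tk (ks + 1)) (\<gamma> s) ** matrix_inv (E s (\<gamma> s)))"

end

theory Submission
  imports Defs
begin

text \<open>
  On one interval \<open>[a, b)\<close> of the partition the delayed argument takes a single value \<open>z\<close>, so with
  \<open>w = y z\<close> the equation is the linear equation \<open>y' = A y + (B w + F)\<close>.  Variation of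
  constants from \<open>z\<close> gives \<open>y t = E t z w + q t\<close> with \<open>q t\<close> the integral of \<open>\<Phi> t s F s\<close> over
  \<open>s\<close> from \<open>z\<close> to \<open>t\<close>.  At \<open>t = a\<close> this is a linear equation for the unknown \<open>w\<close>; when
  \<open>E a z\<close> is invertible it yields \<open>y t = M t (y a - q a) + q t\<close> with \<open>M t = E t z (E a z)\<^sup>-\<^sup>1\<close>
  (\<open>piece_solution_unique\<close>, and \<open>piece_solution_deriv\<close> for the converse).

  Together with the jump conditions this turns the initial value problem into a recursion over
  the intervals (\<open>ivp_solution_iff_recursion\<close>).  In terms of \<open>X k = y a - q a\<close>, where \<open>a\<close> is the
  start of interval \<open>k\<close>, the recursion is affine: \<open>X (k + 1) = (I + C) M X k + c (k + 1)\<close>, where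
  \<open>c\<close> collects impulses and forcing.  It unrolls to a sum over the earlier intervals
  (\<open>recursion_iff_closed_form\<close>).  The explicit product defining \<open>W\<close> is the product of these
  one-interval factors (\<open>W_mat_eq\<close>), and splitting \<open>c\<close> into its constituents produces the
  terms of the variation of parameters formula (\<open>variation_of_parameters_closed_form\<close>).

  Invertibility of \<open>E a z\<close> is assumed on the initial interval.  On the later ones it follows from
  the smallness of \<open>\<nu>\<^sup>+\<close>: by Gronwall's inequality \<open>N (\<Phi> z u B u)\<close> is at most \<open>\<rho>\<^sup>+(A) N (B u)\<close>,
  so that \<open>J\<close> differs from the identity by a matrix with \<open>N\<close> less than 1
  (\<open>invertible_J_mat\<close>).  Only Gronwall's inequality forward in time is needed, also for
  uniqueness backwards, because it already makes every \<open>\<Phi> t s\<close> invertible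
  (\<open>transition_matrix_cocycle\<close>).
\<close>

section \<open>Matrix calculus\<close>

lemma bounded_bilinear_matrix_mult:
  "bounded_bilinear ((**) :: real^'n^'m \<Rightarrow> real^'p^'n \<Rightarrow> real^'p^'m)"
  unfolding bilinear_conv_bounded_bilinear[symmetric] bilinear_def linear_iff
  by (auto simp: matrix_matrix_mult_def vec_eq_iff sum.distrib sum_distrib_left algebra_simps)

lemma bounded_bilinear_matrix_vector_mult:
  "bounded_bilinear ((*v) :: real^'n^'m \<Rightarrow> real^'n \<Rightarrow> real^'m)"
  unfolding bilinear_conv_bounded_bilinear[symmetric] bilinear_def linear_iff
  by (auto simp: algebra_simps scaleR_matrix_vector_assoc)

lemmas bounded_linear_matrix_mult_left =
  bounded_bilinear.bounded_linear_left[OF bounded_bilinear_matrix_mult]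
lemmas bounded_linear_matrix_vector_mult_left =
  bounded_bilinear.bounded_linear_left[OF bounded_bilinear_matrix_vector_mult]
lemmas bounded_linear_matrix_vector_mult_right =
  bounded_bilinear.bounded_linear_right[OF bounded_bilinear_matrix_vector_mult]

lemmas continuous_on_matrix_mult =
  bounded_bilinear.continuous_on[OF bounded_bilinear_matrix_mult]
lemmas continuous_on_matrix_vector_mult =
  bounded_bilinear.continuous_on[OF bounded_bilinear_matrix_vector_mult]
lemmas has_vector_derivative_matrix_vector_mult =
  bounded_bilinear.has_vector_derivative[OF bounded_bilinear_matrix_vector_mult]

lemma matrix_inv_mult_right:
  fixes P :: "real^'n^'n"
  assumes "invertible P"
  shows "P ** matrix_inv P = mat 1"
  using assms unfolding invertible_def matrix_inv_def by (metis (mono_tags, lifting) someI_ex)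

lemma continuous_on_det:
  fixes M :: "'a::topological_space \<Rightarrow> real^'n^'n"
  assumes "\<And>i j. continuous_on S (\<lambda>x. M x $ i $ j)"
  shows "continuous_on S (\<lambda>x. det (M x))"
  unfolding det_def by (intro continuous_intros assms)

text \<open>Cramer's rule displays the entries of an inverse as quotients of determinants, so
  inversion preserves continuity.\<close>

lemma continuous_on_matrix_inverse:
  fixes P Q :: "'a::topological_space \<Rightarrow> real^'n^'n"
  assumes contP: "continuous_on S P"
    and PQ: "\<And>x. x \<in> S \<Longrightarrow> P x ** Q x = mat 1"
  shows "continuous_on S Q"
proof -
  have det0: "det (P x) \<noteq> 0" if "x \<in> S" for x
    using PQ[OF that] invertible_det_nz invertible_right_inverse by blast
  have entry: "Q x $ k $ l
      = det (\<chi> i j. if j = k then axis l 1 $ i else P x $ i $ j) / det (P x)"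
    if x: "x \<in> S" for x k l
  proof -
    have "P x *v column l (Q x) = axis l 1"
      using PQ[OF x] by (simp add: matrix_matrix_mult_def matrix_vector_mult_def column_def
          vec_eq_iff mat_def axis_def)
    then have "column l (Q x)
        = (\<chi> k. det (\<chi> i j. if j = k then axis l 1 $ i else P x $ i $ j) / det (P x))"
      using cramer[OF det0[OF x]] by blast
    then have "column l (Q x) $ k
        = det (\<chi> i j. if j = k then axis l 1 $ i else P x $ i $ j) / det (P x)"
      by simp
    then show ?thesis
      by (simp add: column_def)
  qed
  have cP: "continuous_on S (\<lambda>x. P x $ i $ j)" for i j
    by (intro continuous_intros contP)
  have cif: "continuous_on S (\<lambda>x. if j = k then c else P x $ i $ j)" for i j k c
    by (cases "j = k") (simp_all add: cP)
  have "continuous_on S (\<lambda>x. Q x $ k $ l)" for k l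
  proof -
    have "continuous_on S (\<lambda>x. det (\<chi> i j. if j = k then axis l 1 $ i
            else P x $ i $ j) / det (P x))"
      by (intro continuous_on_divide continuous_on_det)
        (simp_all add: det0 cP cif)
    then show ?thesis
      by (rule continuous_on_eq) (simp add: entry)
  qed
  then have "continuous_on S (\<lambda>x. \<chi> k l. Q x $ k $ l)"
    by (intro continuous_on_vec_lambda)
  then show ?thesis by simp
qed

section \<open>Oriented integrals\<close>

lemma LBINT_has_vector_derivative:
  fixes f :: "real \<Rightarrow> 'a::euclidean_space" and c t :: real
  assumes f: "continuous_on UNIV f"
  shows "((\<lambda>t. LBINT u=c..t. f u) has_vector_derivative f t) (at t)"
proof -
  have "((\<lambda>t. LBINT u=c..t. f u) has_vector_derivative f t)
      (at t within {min c t - 1..max c t + 1})"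
    by (rule interval_integral_FTC2) (auto intro: continuous_on_subset[OF f])
  moreover have "at t within {min c t - 1..max c t + 1} = at t"
    by (rule at_within_interior) (auto simp: min_def max_def)
  ultimately show ?thesis by simp
qed

lemma LBINT_bounded_linear:
  fixes f :: "real \<Rightarrow> 'a::euclidean_space" and L :: "'a \<Rightarrow> 'b::euclidean_space"
    and a b :: real
  assumes f: "continuous_on UNIV f" and L: "bounded_linear L"
  shows "(LBINT u=a..b. L (f u)) = L (LBINT u=a..b. f u)"
proof -
  let ?d = "\<lambda>t::real. (LBINT u=a..t. L (f u)) - L (LBINT u=a..t. f u)"
  have Lf: "continuous_on UNIV (\<lambda>u. L (f u))"
    using L f by (rule bounded_linear.continuous_on)
  have der: "(?d has_vector_derivative 0) (at t within UNIV)" for t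
    using has_vector_derivative_diff[OF LBINT_has_vector_derivative[OF Lf]
        bounded_linear.has_vector_derivative[OF L LBINT_has_vector_derivative[OF f]]]
    by simp
  obtain c where c: "\<And>t. ?d t = c"
    by (rule has_vector_derivative_zero_constant[OF convex_UNIV der]) (rule that, simp)
  have "?d a = 0"
    using L by (simp add: linear_0 bounded_linear.linear)
  then have "?d b = 0"
    using c[of a] c[of b] by simp
  then show ?thesis by simp
qed

lemma LBINT_eq_integral:
  fixes f :: "real \<Rightarrow> 'a::euclidean_space" and a b :: real
  assumes "continuous_on UNIV f" "a \<le> b"
  shows "(LBINT u=a..b. f u) = integral {a..b} f"
  using assms
  by (intro interval_integral_eq_integral borel_integrable_atLeastAtMost')
    (auto intro: continuous_on_subset)

section \<open>A Gronwall inequality for seminorms\<close>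

definition is_seminorm :: "('a::real_vector \<Rightarrow> real) \<Rightarrow> bool" where
  "is_seminorm p \<longleftrightarrow>
     (\<forall>x y. p (x + y) \<le> p x + p y) \<and> (\<forall>c x. p (c *\<^sub>R x) = \<bar>c\<bar> * p x)"

lemma is_seminorm_zero: "is_seminorm p \<Longrightarrow> p 0 = 0"
  unfolding is_seminorm_def by (metis abs_zero mult_zero_left scaleR_zero_left)

lemma is_seminorm_add: "is_seminorm p \<Longrightarrow> p (x + y) \<le> p x + p y"
  by (simp add: is_seminorm_def)

lemma is_seminorm_scaleR: "is_seminorm p \<Longrightarrow> p (c *\<^sub>R x) = \<bar>c\<bar> * p x"
  by (simp add: is_seminorm_def)

lemma is_seminorm_minus: "is_seminorm p \<Longrightarrow> p (- x) = p x"
  using is_seminorm_scaleR[of p "-1" x] by simp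

lemma is_seminorm_sum_le:
  assumes "is_seminorm p"
  shows "p (sum f S) \<le> (\<Sum>x\<in>S. p (f x))"
proof (induction S rule: infinite_finite_induct)
  case (insert x F)
  then show ?case
    using is_seminorm_add[OF assms, of "f x" "sum f F"] by simp
qed (auto simp: is_seminorm_zero[OF assms])

lemma continuous_on_is_seminorm:
  fixes p :: "'a::euclidean_space \<Rightarrow> real"
  assumes p: "is_seminorm p"
  shows "continuous_on UNIV p"
proof (rule convex_on_continuous)
  show "convex_on UNIV p"
  proof (intro convex_onI)
    fix t :: real and x y :: 'a
    assume "0 < t" "t < 1"
    then show "p ((1 - t) *\<^sub>R x + t *\<^sub>R y) \<le> (1 - t) * p x + t * p y"
      using is_seminorm_add[OF p, of "(1 - t) *\<^sub>R x" "t *\<^sub>R y"]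
      by (simp add: is_seminorm_scaleR[OF p])
  qed simp
qed simp

text \<open>The bound holds for Riemann sums by the triangle inequality and survives the limit because
  a seminorm on a finite-dimensional space is continuous.\<close>

lemma is_seminorm_integral_le:
  fixes p :: "'a::euclidean_space \<Rightarrow> real" and f :: "real \<Rightarrow> 'a"
  assumes p: "is_seminorm p"
    and f: "(f has_integral I) {a..b}" and g: "(g has_integral J) {a..b}"
    and le: "\<And>x. x \<in> {a..b} \<Longrightarrow> p (f x) \<le> g x"
  shows "p I \<le> J"
proof -
  let ?D = "division_filter (cbox a b)"
  have "((\<lambda>q. \<Sum>(x,k)\<in>q. measure lborel k *\<^sub>R f x) \<longlongrightarrow> I) ?D"
    using f by (intro has_integral_cbox[THEN iffD1]) simp
  then have 1: "((\<lambda>q. p (\<Sum>(x,k)\<in>q. measure lborel k *\<^sub>R f x)) \<longlongrightarrow> p I) ?D"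
    using continuous_on_tendsto_compose[OF continuous_on_is_seminorm[OF p]] by force
  have 2: "((\<lambda>q. \<Sum>(x,k)\<in>q. measure lborel k *\<^sub>R g x) \<longlongrightarrow> J) ?D"
    using g by (intro has_integral_cbox[THEN iffD1]) simp
  have 3: "p (\<Sum>(x,k)\<in>q. measure lborel k *\<^sub>R f x) \<le> (\<Sum>(x,k)\<in>q. measure lborel k *\<^sub>R g x)"
    if q: "q tagged_division_of cbox a b" for q
  proof -
    have "p (\<Sum>(x,k)\<in>q. measure lborel k *\<^sub>R f x) \<le> (\<Sum>xk\<in>q. p (case xk of (x,k) \<Rightarrow> measure lborel k *\<^sub>R f x))"
      by (rule is_seminorm_sum_le[OF p])
    also have "\<dots> \<le> (\<Sum>(x,k)\<in>q. measure lborel k *\<^sub>R g x)"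
    proof (rule sum_mono)
      fix xk assume xk: "xk \<in> q"
      obtain x k where [simp]: "xk = (x, k)" by force
      have "x \<in> {a..b}"
        using tag_in_interval[OF q, of x k] xk by simp
      then have "measure lborel k * p (f x) \<le> measure lborel k * g x"
        by (intro mult_left_mono le) auto
      then show "p (case xk of (x,k) \<Rightarrow> measure lborel k *\<^sub>R f x)
          \<le> (case xk of (x,k) \<Rightarrow> measure lborel k *\<^sub>R g x)"
        by (simp add: is_seminorm_scaleR[OF p])
    qed
    finally show ?thesis .
  qed
  show ?thesis
    by (rule tendsto_le[OF division_filter_not_empty 2 1])
      (use eventually_division_filter_tagged_division[of "cbox a b"] 3 in \<open>auto elim: eventually_mono\<close>)
qed

text \<open>The integral form \<open>p (x t) \<le> h t\<close> with \<open>h' = \<alpha> * p x \<le> \<alpha> * h\<close> makes \<open>h\<close> divided by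
  the exponential decreasing.\<close>

lemma gronwall_seminorm:
  fixes p :: "'a::euclidean_space \<Rightarrow> real" and x v :: "real \<Rightarrow> 'a"
  assumes p: "is_seminorm p" and ab: "a \<le> b"
    and x: "\<And>t. t \<in> {a..b} \<Longrightarrow> (x has_vector_derivative v t) (at t within {a..b})"
    and \<alpha>: "continuous_on {a..b} \<alpha>" and \<alpha>0: "\<And>t. t \<in> {a..b} \<Longrightarrow> 0 \<le> \<alpha> t"
    and le: "\<And>t. t \<in> {a..b} \<Longrightarrow> p (v t) \<le> \<alpha> t * p (x t)"
  shows "p (x b) \<le> p (x a) * exp (integral {a..b} \<alpha>)"
proof -
  let ?g = "\<lambda>s. \<alpha> s * p (x s)"
  define h where "h t = p (x a) + integral {a..t} ?g" for t
  define H where "H t = h t * exp (- integral {a..t} \<alpha>)" for t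
  have contx: "continuous_on {a..b} x"
    using x has_vector_derivative_continuous by (force simp: continuous_on_eq_continuous_within)
  have contpx: "continuous_on {a..b} (\<lambda>s. p (x s))"
    using continuous_on_compose2[OF continuous_on_is_seminorm[OF p] contx] by simp
  have contg: "continuous_on {a..b} ?g"
    by (intro continuous_intros \<alpha> contpx)
  have pxh: "p (x t) \<le> h t" if t: "t \<in> {a..b}" for t
  proof -
    have "(v has_integral (x t - x a)) {a..t}"
      using t by (intro fundamental_theorem_of_calculus)
        (auto intro: has_vector_derivative_within_subset[OF x])
    moreover have "(?g has_integral integral {a..t} ?g) {a..t}"
      using t by (intro integrable_integral integrable_continuous_real
          continuous_on_subset[OF contg]) auto
    ultimately have "p (x t - x a) \<le> integral {a..t} ?g"
      by (rule is_seminorm_integral_le[OF p]) (use t le in auto)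
    then show ?thesis
      using is_seminorm_add[OF p, of "x t - x a" "x a"] by (simp add: h_def)
  qed
  have dH: "(H has_real_derivative
      (?g t * exp (- integral {a..t} \<alpha>) + h t * (exp (- integral {a..t} \<alpha>) * (- \<alpha> t))))
      (at t within {a..b})" if t: "t \<in> {a..b}" for t
  proof -
    have 1: "((\<lambda>t. integral {a..t} ?g) has_real_derivative ?g t) (at t within {a..b})"
      using integral_has_vector_derivative[OF contg t]
      by (simp add: has_real_derivative_iff_has_vector_derivative)
    have 2: "((\<lambda>t. integral {a..t} \<alpha>) has_real_derivative \<alpha> t) (at t within {a..b})"
      using integral_has_vector_derivative[OF \<alpha> t]
      by (simp add: has_real_derivative_iff_has_vector_derivative)
    show ?thesis
      unfolding H_def h_def
      by (rule derivative_eq_intros 1 2 refl | simp)+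
  qed
  have "H b \<le> H a"
  proof (rule DERIV_nonpos_imp_decreasing_open[OF ab])
    fix t assume t: "a < t" "t < b"
    let ?D = "?g t * exp (- integral {a..t} \<alpha>) + h t * (exp (- integral {a..t} \<alpha>) * (- \<alpha> t))"
    have "at t within {a..b} = at t"
      using t by (intro at_within_interior) auto
    then have "DERIV H t :> ?D"
      using dH[of t] t by simp
    moreover have "?D = exp (- integral {a..t} \<alpha>) * \<alpha> t * (p (x t) - h t)"
      by (simp add: algebra_simps)
    moreover have "\<dots> \<le> 0"
      using pxh[of t] \<alpha>0[of t] t by (intro mult_nonneg_nonpos) auto
    ultimately show "\<exists>y. DERIV H t :> y \<and> y \<le> 0"
      by metis
  next
    show "continuous_on {a..b} H"
      using dH by (rule DERIV_continuous_on)
  qed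
  then have "h b * exp (- integral {a..b} \<alpha>) \<le> p (x a)"
    by (simp add: H_def h_def)
  then have "h b \<le> p (x a) * exp (integral {a..b} \<alpha>)"
    by (simp add: exp_minus field_simps)
  then show ?thesis
    using pxh[of b] ab by auto
qed

section \<open>Linear differential equations\<close>

lemma linear_ode_zero_forward:
  fixes A :: "real \<Rightarrow> real^'n^'n" and x :: "real \<Rightarrow> real^'n"
  assumes A: "continuous_on UNIV A" and ab: "a \<le> b"
    and x: "\<And>t. t \<in> {a..b} \<Longrightarrow> (x has_vector_derivative A t *v x t) (at t within {a..b})"
    and "x a = 0"
  shows "x b = 0"
proof -
  obtain K where K: "0 < K" "\<And>M w. norm ((M::real^'n^'n) *v w) \<le> norm M * norm w * K"
    using bounded_bilinear.pos_bounded[OF bounded_bilinear_matrix_vector_mult] by blast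
  have "norm (x b) \<le> norm (x a) * exp (integral {a..b} (\<lambda>t. norm (A t) * K))"
  proof (rule gronwall_seminorm[OF _ ab x])
    show "is_seminorm (norm :: real^'n \<Rightarrow> real)"
      by (simp add: is_seminorm_def norm_triangle_ineq)
    show "continuous_on {a..b} (\<lambda>t. norm (A t) * K)"
      by (intro continuous_intros continuous_on_subset[OF A]) auto
    show "0 \<le> norm (A t) * K" for t
      using K(1) by simp
    show "norm (A t *v x t) \<le> norm (A t) * K * norm (x t)" for t
      using K(2)[of "A t" "x t"] by (simp add: mult_ac)
  qed
  then show ?thesis
    using \<open>x a = 0\<close> by simp
qed

lemma transition_matrix_refl: "transition_matrix A \<Phi> \<Longrightarrow> \<Phi> s s = mat 1"
  by (simp add: transition_matrix_def)

context
  fixes A :: "real \<Rightarrow> real^'n^'n" and \<Phi> :: "real \<Rightarrow> real \<Rightarrow> real^'n^'n"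
  assumes contA: "continuous_on UNIV A" and Phi: "transition_matrix A \<Phi>"
begin

lemma transition_matrix_deriv:
  "((\<lambda>t. \<Phi> t s *v w) has_vector_derivative A t *v (\<Phi> t s *v w)) (at t within S)"
proof -
  have "((\<lambda>t. \<Phi> t s) has_vector_derivative A t ** \<Phi> t s) (at t)"
    using Phi by (simp add: transition_matrix_def)
  from bounded_linear.has_vector_derivative[OF bounded_linear_matrix_vector_mult_left this]
  show ?thesis
    by (simp add: matrix_vector_mul_assoc has_vector_derivative_at_within)
qed

lemma linear_ode_forward:
  assumes ab: "a \<le> b"
    and x: "\<And>t. t \<in> {a..b} \<Longrightarrow> (x has_vector_derivative A t *v x t) (at t within {a..b})"
  shows "x b = \<Phi> b a *v x a"
proof -
  have "x b - \<Phi> b a *v x a = 0"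
  proof (rule linear_ode_zero_forward[OF contA ab])
    fix t assume "t \<in> {a..b}"
    then show "((\<lambda>t. x t - \<Phi> t a *v x a) has_vector_derivative
        A t *v (x t - \<Phi> t a *v x a)) (at t within {a..b})"
      using has_vector_derivative_diff[OF x transition_matrix_deriv]
      by (simp add: matrix_vector_mult_diff_distrib)
  qed (simp add: transition_matrix_refl[OF Phi])
  then show ?thesis by simp
qed

text \<open>Uniqueness of solutions yields the cocycle law for \<open>s \<le> t\<close> directly.  It then shows that
  \<open>\<Phi> s t\<close> inverts \<open>\<Phi> t s\<close>, and this turns the law for \<open>t \<le> s\<close> into the one already known.\<close>

lemma transition_matrix_cocycle: "\<Phi> t s ** \<Phi> s u = \<Phi> t u"
proof -
  have forward: "\<Phi> t s ** \<Phi> s u = \<Phi> t u" if "s \<le> t" for s t u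
  proof -
    have "\<Phi> t u *v w = \<Phi> t s *v (\<Phi> s u *v w)" for w
      by (rule linear_ode_forward[OF that transition_matrix_deriv])
    then show ?thesis
      by (simp add: matrix_eq matrix_vector_mul_assoc)
  qed
  show ?thesis
  proof (cases "s \<le> t")
    case False
    then have "\<Phi> s t ** \<Phi> t s = mat 1" "\<Phi> s t ** \<Phi> t u = \<Phi> s u"
      using forward[of t s] by (simp_all add: transition_matrix_refl[OF Phi])
    then show ?thesis
      by (metis matrix_left_right_inverse matrix_mul_assoc matrix_mul_lid)
  qed (rule forward)
qed

lemma transition_matrix_inverse: "\<Phi> t s ** \<Phi> s t = mat 1"
  by (simp add: transition_matrix_cocycle transition_matrix_refl[OF Phi])

lemma continuous_on_transition_matrix: "continuous_on UNIV (\<lambda>u. \<Phi> s u)"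
proof (rule continuous_on_matrix_inverse[where P = "\<lambda>u. \<Phi> u s"])
  show "continuous_on UNIV (\<lambda>u. \<Phi> u s)"
    using Phi unfolding transition_matrix_def continuous_on_eq_continuous_within
    by (auto intro: has_vector_derivative_continuous)
qed (rule transition_matrix_inverse)

lemma linear_ode_zero:
  assumes x: "\<And>t. (x has_vector_derivative A t *v x t) (at t)" and "x s = 0"
  shows "x t = 0"
proof (cases "s \<le> t")
  case True
  then show ?thesis
    using linear_ode_forward[of s t x] assms by (simp add: has_vector_derivative_at_within)
next
  case False
  then have "\<Phi> s t *v x t = 0"
    using linear_ode_forward[of t s x] assms by (simp add: has_vector_derivative_at_within)
  then have "(\<Phi> t s ** \<Phi> s t) *v x t = 0"
    by (simp flip: matrix_vector_mul_assoc)
  then show ?thesis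
    by (simp add: transition_matrix_inverse)
qed

lemma continuous_on_transition_matrix_mult:
  "continuous_on UNIV g \<Longrightarrow> continuous_on UNIV (\<lambda>u. \<Phi> s u *v g u)"
  by (intro continuous_on_matrix_vector_mult continuous_on_transition_matrix)

lemma variation_of_constants_deriv:
  assumes g: "continuous_on UNIV g"
  shows "((\<lambda>t. \<Phi> t s *v (c + (LBINT u=s..t. \<Phi> s u *v g u))) has_vector_derivative
      A t *v (\<Phi> t s *v (c + (LBINT u=s..t. \<Phi> s u *v g u))) + g t) (at t)"
proof -
  have "((\<lambda>t. c + (LBINT u=s..t. \<Phi> s u *v g u)) has_vector_derivative 0 + \<Phi> s t *v g t) (at t)"
    by (intro has_vector_derivative_add has_vector_derivative_const
        LBINT_has_vector_derivative continuous_on_transition_matrix_mult g)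
  moreover have "((\<lambda>t. \<Phi> t s) has_vector_derivative A t ** \<Phi> t s) (at t)"
    using Phi by (simp add: transition_matrix_def)
  ultimately show ?thesis
    using has_vector_derivative_matrix_vector_mult
    by (fastforce simp: matrix_vector_mul_assoc transition_matrix_inverse add.commute)
qed

lemma LBINT_transition_matrix:
  fixes a b :: real
  assumes g: "continuous_on UNIV g"
  shows "(LBINT u=a..b. \<Phi> t u *v g u) = \<Phi> t s *v (LBINT u=a..b. \<Phi> s u *v g u)"
  using LBINT_bounded_linear[OF continuous_on_transition_matrix_mult[OF g, of s]
      bounded_linear_matrix_vector_mult_right[of "\<Phi> t s"], where a = a and b = b]
  by (simp add: matrix_vector_mul_assoc transition_matrix_cocycle)

text \<open>The factor \<open>M\<close> absorbs the value \<open>N (mat 1)\<close>, which may exceed 1: the bound for \<open>\<Phi>\<close>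
  alone would carry it.\<close>

lemma transition_matrix_mult_bound:
  fixes M :: "real^'n^'n"
  assumes N: "matrix_norm N" and ab: "a \<le> b"
  shows "N (\<Phi> b a ** M) \<le> exp (LBINT u=a..b. N (A u)) * N M"
proof -
  have sN: "is_seminorm N"
    using N by (simp add: matrix_norm_def is_seminorm_def)
  have NA: "continuous_on UNIV (\<lambda>u. N (A u))"
    using continuous_on_compose2[OF continuous_on_is_seminorm[OF sN] contA] by simp
  have "N (\<Phi> b a ** M) \<le> N (\<Phi> a a ** M) * exp (integral {a..b} (\<lambda>u. N (A u)))"
  proof (rule gronwall_seminorm[OF sN ab])
    fix t
    have "((\<lambda>t. \<Phi> t a) has_vector_derivative A t ** \<Phi> t a) (at t)"
      using Phi by (simp add: transition_matrix_def)
    from bounded_linear.has_vector_derivative[OF bounded_linear_matrix_mult_left[of M] this]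
    show "((\<lambda>t. \<Phi> t a ** M) has_vector_derivative A t ** (\<Phi> t a ** M)) (at t within {a..b})"
      by (simp add: matrix_mul_assoc has_vector_derivative_at_within)
    show "N (A t ** (\<Phi> t a ** M)) \<le> N (A t) * N (\<Phi> t a ** M)" "0 \<le> N (A t)"
      using N by (simp_all add: matrix_norm_def)
    show "continuous_on {a..b} (\<lambda>u. N (A u))"
      using NA continuous_on_subset by blast
  qed
  then show ?thesis
    by (simp add: transition_matrix_refl[OF Phi] LBINT_eq_integral[OF NA ab] mult.commute)
qed

end

section \<open>Invertibility of the matrices J and E\<close>

text \<open>A kernel vector of \<open>mat 1 + M\<close>, repeated in every column of a matrix \<open>X\<close>, gives
  \<open>M ** X = - X\<close>, so submultiplicativity forces \<open>N X = 0\<close>.  This avoids a Neumann series and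
  does not involve the value of \<open>N\<close> at the identity.\<close>

lemma invertible_mat_1_add:
  fixes M :: "real^'n^'n"
  assumes N: "matrix_norm N" and M: "N M < 1"
  shows "invertible (mat 1 + M)"
proof -
  have "x = 0" if x: "(mat 1 + M) *v x = 0" for x :: "real^'n"
  proof -
    define X :: "real^'n^'n" where "X = (\<chi> i j. x $ i)"
    have "M *v x = - x"
      using x by (simp add: matrix_vector_mult_add_rdistrib eq_neg_iff_add_eq_0 add.commute)
    then have "M ** X = - X"
      by (simp add: X_def matrix_matrix_mult_def matrix_vector_mult_def vec_eq_iff)
    moreover have "N (- X) = N X"
    proof -
      have "N ((-1) *\<^sub>R X) = \<bar>-1\<bar> * N X"
        using N unfolding matrix_norm_def by blast
      then show ?thesis by simp
    qed
    ultimately have "N X \<le> N M * N X"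
      using N unfolding matrix_norm_def by metis
    moreover have "0 \<le> N X"
      using N by (simp add: matrix_norm_def)
    ultimately have "N X = 0"
      using M by (smt (verit) mult_left_le_one_le mult_le_cancel_right1)
    then have "X = 0"
      using N by (simp add: matrix_norm_def)
    then show ?thesis
      by (simp add: X_def vec_eq_iff)
  qed
  then show ?thesis
    by (metis invertible_left_inverse matrix_left_invertible_ker)
qed

lemma invertible_J_mat:
  fixes A B :: "real \<Rightarrow> real^'n^'n"
  assumes A: "continuous_on UNIV A" and Phi: "transition_matrix A \<Phi>"
    and B: "continuous_on UNIV B" and N: "matrix_norm N" and az: "a \<le> z"
    and small: "exp (LBINT u=a..z. N (A u)) * (LBINT u=a..z. N (B u)) < 1"
  shows "invertible (J_mat \<Phi> B a z)"
proof -
  have sN: "is_seminorm N"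
    using N by (simp add: matrix_norm_def is_seminorm_def)
  have cN: "continuous_on UNIV (\<lambda>u. N (M u))" if "continuous_on UNIV M" for M :: "real \<Rightarrow> _"
    using continuous_on_compose2[OF continuous_on_is_seminorm[OF sN] that] by simp
  have PB: "continuous_on UNIV (\<lambda>u. \<Phi> z u ** B u)"
    by (intro continuous_on_matrix_mult continuous_on_transition_matrix[OF A Phi] B)
  let ?\<rho> = "exp (LBINT u=a..z. N (A u))"
  have le: "N (\<Phi> z u ** B u) \<le> ?\<rho> * N (B u)" if u: "u \<in> {a..z}" for u
  proof -
    have "integral {u..z} (\<lambda>u. N (A u)) \<le> integral {a..z} (\<lambda>u. N (A u))"
      using u N by (intro integral_subset_le integrable_continuous_real
          continuous_on_subset[OF cN[OF A]]) (auto simp: matrix_norm_def)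
    then have "exp (LBINT u=u..z. N (A u)) \<le> ?\<rho>"
      using u az by (simp add: LBINT_eq_integral[OF cN[OF A]])
    moreover have "0 \<le> N (B u)"
      using N by (simp add: matrix_norm_def)
    ultimately show ?thesis
      using transition_matrix_mult_bound[OF A Phi N, of u z "B u"] u
      by (smt (verit) atLeastAtMost_iff mult_right_mono)
  qed
  have "N (integral {a..z} (\<lambda>u. \<Phi> z u ** B u)) \<le> integral {a..z} (\<lambda>u. ?\<rho> * N (B u))"
    by (rule is_seminorm_integral_le[OF sN integrable_integral integrable_integral le])
      (auto intro!: integrable_continuous_real continuous_intros
        continuous_on_subset[OF PB] continuous_on_subset[OF cN[OF B]])
  also have "\<dots> = ?\<rho> * (LBINT u=a..z. N (B u))"
    by (simp add: LBINT_eq_integral[OF cN[OF B] az])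
  also note small
  finally have "N (LBINT u=z..a. \<Phi> z u ** B u) < 1"
    unfolding interval_integral_endpoints_reverse[of z a]
    by (simp add: LBINT_eq_integral[OF PB az] is_seminorm_minus[OF sN])
  then show ?thesis
    unfolding J_mat_def by (rule invertible_mat_1_add[OF N])
qed

section \<open>The equation on a single interval\<close>

text \<open>The part of the solution due to \<open>F\<close>, normalised to vanish at \<open>z\<close>.\<close>

definition forced_part ::
    "(real \<Rightarrow> real \<Rightarrow> real^'n^'n) \<Rightarrow> (real \<Rightarrow> real^'n) \<Rightarrow> real \<Rightarrow> real \<Rightarrow> real^'n" where
  "forced_part \<Phi> F z t = (LBINT s=z..t. \<Phi> t s *v F s)"

text \<open>The matrix \<open>W\<close> within one interval, which maps the value at \<open>a\<close> of a homogeneous solution to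
  its value at \<open>t\<close>.\<close>

definition piece_propagator ::
    "(real \<Rightarrow> real \<Rightarrow> real^'n^'n) \<Rightarrow> (real \<Rightarrow> real^'n^'n) \<Rightarrow> real \<Rightarrow> real \<Rightarrow> real \<Rightarrow> real^'n^'n" where
  "piece_propagator \<Phi> B z a t = E_mat \<Phi> B t z ** matrix_inv (E_mat \<Phi> B a z)"

text \<open>Subtracting \<open>forced_part \<Phi> F z a\<close> leaves the homogeneous part of the starting value \<open>x\<close>.
  Since the integral is oriented, the difference is \<open>x\<close> plus the integral of \<open>\<Phi> a s F s\<close> over
  \<open>s\<close> from \<open>a\<close> to \<open>z\<close>, as in the variation of parameters formula.\<close>

definition piece_solution ::
    "(real \<Rightarrow> real \<Rightarrow> real^'n^'n) \<Rightarrow> (real \<Rightarrow> real^'n^'n) \<Rightarrow> (real \<Rightarrow> real^'n) \<Rightarrow>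
     real \<Rightarrow> real \<Rightarrow> real^'n \<Rightarrow> real \<Rightarrow> real^'n" where
  "piece_solution \<Phi> B F z a x t =
     piece_propagator \<Phi> B z a t *v (x - forced_part \<Phi> F z a) + forced_part \<Phi> F z t"

lemma left_limit_eqI:
  assumes ab: "a < b" and eq: "\<And>t. t \<in> {a..<b} \<Longrightarrow> y t = G t" and G: "isCont G b"
  shows "(y \<longlongrightarrow> G b) (at_left b)" and "left_limit y b = G b"
proof -
  have "eventually (\<lambda>t. t \<in> {a<..<b}) (at_left b)"
    using ab by (rule eventually_at_leftI[rotated]) simp
  then have "eventually (\<lambda>t. G t = y t) (at_left b)"
    by eventually_elim (simp add: eq)
  moreover have "(G \<longlongrightarrow> G b) (at_left b)"
    using G unfolding isCont_def by (rule filterlim_mono) (auto simp: at_le)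
  ultimately show *: "(y \<longlongrightarrow> G b) (at_left b)"
    by (rule Lim_transform_eventually[rotated])
  show "left_limit y b = G b"
    unfolding left_limit_def by (rule tendsto_Lim[OF _ *]) simp
qed

context
  fixes A B :: "real \<Rightarrow> real^'n^'n" and F :: "real \<Rightarrow> real^'n"
    and \<Phi> :: "real \<Rightarrow> real \<Rightarrow> real^'n^'n"
  assumes contA: "continuous_on UNIV A" and contB: "continuous_on UNIV B"
    and contF: "continuous_on UNIV F" and Phi: "transition_matrix A \<Phi>"
begin

lemma invertible_E_mat_iff: "invertible (E_mat \<Phi> B a z) \<longleftrightarrow> invertible (J_mat \<Phi> B a z)"
proof -
  have "invertible (\<Phi> a z)"
    using transition_matrix_inverse[OF contA Phi] invertible_right_inverse by blast
  then show ?thesis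
    unfolding E_mat_def by (simp add: invertible_det_nz det_mul)
qed

lemma continuous_on_frozen_force: "continuous_on UNIV (\<lambda>u. B u *v w + F u)"
  by (intro continuous_intros continuous_on_matrix_vector_mult contB contF)

text \<open>With the delayed value frozen to \<open>w\<close> the equation is linear with forcing \<open>B w + F\<close>; the
  matrix \<open>E\<close> collects the terms that depend on \<open>w\<close>.\<close>

lemma E_mat_forced_part:
  "E_mat \<Phi> B t z *v w + forced_part \<Phi> F z t
     = \<Phi> t z *v (w + (LBINT u=z..t. \<Phi> z u *v (B u *v w + F u)))"
proof -
  have c1: "continuous_on UNIV (\<lambda>u. \<Phi> z u ** B u)"
    by (intro continuous_on_matrix_mult continuous_on_transition_matrix[OF contA Phi] contB)
  have c2: "continuous_on UNIV (\<lambda>u. (\<Phi> z u ** B u) *v w)"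
    by (intro continuous_on_matrix_vector_mult c1 continuous_intros)
  have c3: "continuous_on UNIV (\<lambda>u. \<Phi> z u *v F u)"
    by (rule continuous_on_transition_matrix_mult[OF contA Phi contF])
  have int: "interval_lebesgue_integrable lborel (ereal z) (ereal t) f"
    if "continuous_on UNIV f" for f :: "real \<Rightarrow> real^'n"
    using that by (intro interval_integrable_isCont)
      (simp add: continuous_on_eq_continuous_at)
  have "(LBINT u=z..t. \<Phi> z u *v (B u *v w + F u))
      = (LBINT u=z..t. (\<Phi> z u ** B u) *v w + \<Phi> z u *v F u)"
    by (simp add: matrix_vector_right_distrib matrix_vector_mul_assoc)
  also have "\<dots> = (LBINT u=z..t. (\<Phi> z u ** B u) *v w) + (LBINT u=z..t. \<Phi> z u *v F u)"
    by (rule interval_lebesgue_integral_add(2)[OF int[OF c2] int[OF c3]])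
  also have "(LBINT u=z..t. (\<Phi> z u ** B u) *v w) = (LBINT u=z..t. \<Phi> z u ** B u) *v w"
    by (rule LBINT_bounded_linear[OF c1 bounded_linear_matrix_vector_mult_left])
  finally show ?thesis
    unfolding forced_part_def LBINT_transition_matrix[OF contA Phi contF, of z t t z]
    by (simp add: E_mat_def J_mat_def matrix_vector_right_distrib matrix_vector_mult_add_rdistrib
        add.assoc flip: matrix_vector_mul_assoc)
qed

lemma piece_solution_deriv:
  "((piece_solution \<Phi> B F z a x) has_vector_derivative
     (A t *v piece_solution \<Phi> B F z a x t + B t *v piece_solution \<Phi> B F z a x z + F t)) (at t)"
proof -
  define w where "w = matrix_inv (E_mat \<Phi> B a z) *v (x - forced_part \<Phi> F z a)"
  have eq: "piece_solution \<Phi> B F z a x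
      = (\<lambda>t. \<Phi> t z *v (w + (LBINT u=z..t. \<Phi> z u *v (B u *v w + F u))))"
    unfolding E_mat_forced_part[symmetric]
    by (simp add: fun_eq_iff piece_solution_def piece_propagator_def w_def matrix_vector_mul_assoc)
  have "piece_solution \<Phi> B F z a x z = w"
    by (simp add: eq transition_matrix_refl[OF Phi])
  then show ?thesis
    using variation_of_constants_deriv[OF contA Phi continuous_on_frozen_force, of z w w t]
    by (simp add: eq add.assoc)
qed

text \<open>Two applications of uniqueness determine the solution.  Started at \<open>a\<close>, it is the
  variation of constants formula with the unknown delayed value \<open>v\<close>.  That formula makes sense on
  the whole line, so it can be restarted at \<open>z\<close>, where its value is \<open>v\<close>; evaluating at \<open>a\<close> then
  determines \<open>v\<close> by inverting \<open>E a z\<close>.\<close>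

lemma piece_solution_unique:
  assumes ab: "a < b" and z: "a \<le> z" "z \<le> b" and inv: "invertible (E_mat \<Phi> B a z)"
    and v: "v = (if z < b then y z else left_limit y b)"
    and y: "\<And>t. t \<in> {a..<b} \<Longrightarrow>
      (y has_vector_derivative (A t *v y t + B t *v v + F t)) (at t within {a..<b})"
    and t: "t \<in> {a..<b}"
  shows "y t = piece_solution \<Phi> B F z a (y a) t"
proof -
  let ?g = "\<lambda>u. B u *v v + F u"
  define G where "G t = \<Phi> t a *v (y a + (LBINT u=a..t. \<Phi> a u *v ?g u))" for t
  define H where "H t = \<Phi> t z *v (v + (LBINT u=z..t. \<Phi> z u *v ?g u))" for t
  have dG: "(G has_vector_derivative A t *v G t + ?g t) (at t)" for t
    unfolding G_def by (rule variation_of_constants_deriv[OF contA Phi continuous_on_frozen_force])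
  have dH: "(H has_vector_derivative A t *v H t + ?g t) (at t)" for t
    unfolding H_def by (rule variation_of_constants_deriv[OF contA Phi continuous_on_frozen_force])
  have Ga: "G a = y a" and Hz: "H z = v"
    by (simp_all add: G_def H_def transition_matrix_refl[OF Phi])
  have yG: "y t = G t" if t: "t \<in> {a..<b}" for t
  proof -
    have "y t - G t = 0"
    proof (rule linear_ode_zero_forward[OF contA])
      fix s assume s: "s \<in> {a..t}"
      have "(y has_vector_derivative (A s *v y s + B s *v v + F s)) (at s within {a..t})"
        using s t by (intro has_vector_derivative_within_subset[OF y]) auto
      from has_vector_derivative_diff[OF this has_vector_derivative_at_within[OF dG]]
      show "((\<lambda>t. y t - G t) has_vector_derivative A s *v (y s - G s)) (at s within {a..t})"
        by (simp add: matrix_vector_mult_diff_distrib add.assoc)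
    qed (use t Ga in auto)
    then show ?thesis by simp
  qed
  have "isCont G b"
    using dG has_vector_derivative_continuous by blast
  then have vG: "v = G z"
    using left_limit_eqI(2)[OF ab yG] v z yG by auto
  have GH: "G t = H t" for t
  proof -
    have "G t - H t = 0"
    proof (rule linear_ode_zero[OF contA Phi])
      show "((\<lambda>t. G t - H t) has_vector_derivative A t *v (G t - H t)) (at t)" for t
        using has_vector_derivative_diff[OF dG dH] by (simp add: matrix_vector_mult_diff_distrib)
      show "G z - H z = 0"
        by (simp add: Hz flip: vG)
    qed
    then show ?thesis by simp
  qed
  have H: "H t = E_mat \<Phi> B t z *v v + forced_part \<Phi> F z t" for t
    by (simp add: H_def E_mat_forced_part)
  have "E_mat \<Phi> B a z *v v = y a - forced_part \<Phi> F z a"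
    using GH[of a] H[of a] Ga by simp
  then have "v = matrix_inv (E_mat \<Phi> B a z) *v (y a - forced_part \<Phi> F z a)"
    by (metis matrix_inv_mult_right[OF inv] matrix_left_right_inverse matrix_vector_mul_assoc
        matrix_vector_mul_lid)
  then show ?thesis
    using yG[OF t] GH[of t] H[of t]
    by (simp add: piece_solution_def piece_propagator_def flip: matrix_vector_mul_assoc)
qed

end

section \<open>The recursion over the intervals\<close>

lemma left_prod_empty: "b < a \<Longrightarrow> left_prod T a b = mat 1"
  by (simp add: left_prod_def)

lemma left_prod_step: "a \<le> b \<Longrightarrow> left_prod T a b = T b ** left_prod T a (b - 1)"
  by (simp add: left_prod_def upto_rec2)

lemma int_strict_mono:
  fixes f :: "int \<Rightarrow> real"
  assumes step: "\<And>k. f k < f (k + 1)" and "i < j"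
  shows "f i < f j"
  using \<open>i < j\<close>
proof (induction j rule: int_gr_induct)
  case (step j)
  then show ?case using assms(1)[of j] by simp
qed (rule step)

lemma interval_index_eqI:
  assumes less: "\<And>k. tk k < tk (k + 1)" and t: "tk k \<le> t" "t < tk (k + 1)"
  shows "interval_index tk t = k"
  unfolding interval_index_def
proof (rule the_equality)
  fix j assume j: "tk j \<le> t \<and> t < tk (j + 1)"
  have mono: "tk i \<le> tk l" if "i \<le> l" for i l
    using int_strict_mono[of tk, OF less, of i l] that by (cases "i = l") auto
  show "j = k"
  proof (rule ccontr)
    assume "j \<noteq> k"
    then consider "j + 1 \<le> k" | "k + 1 \<le> j" by linarith
    then show False
      using mono[of "j + 1" k] mono[of "k + 1" j] j t by cases auto
  qed
qed (use t in simp)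

lemma interval_index_exists:
  fixes tk :: "int \<Rightarrow> real"
  assumes less: "\<And>k. tk k < tk (k + 1)"
    and top: "filterlim tk at_top at_top" and bot: "filterlim tk at_bot at_bot"
  obtains k where "tk k \<le> t" "t < tk (k + 1)"
proof -
  have "eventually (\<lambda>k. t < tk k) at_top"
    using top unfolding filterlim_at_top_dense by blast
  then obtain j where j: "t < tk j"
    by (auto simp: eventually_at_top_linorder)
  have "eventually (\<lambda>k. tk k \<le> t) at_bot"
    using bot unfolding filterlim_at_bot by blast
  then obtain i where i: "tk i \<le> t"
    by (auto simp: eventually_at_bot_linorder)
  have "\<exists>k. tk k \<le> t \<and> t < tk (k + 1)"
  proof (rule ccontr)
    assume no: "\<nexists>k. tk k \<le> t \<and> t < tk (k + 1)"
    have le: "tk k \<le> t" if "i \<le> k" for k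
      using that
    proof (induction k rule: int_ge_induct)
      case (step k)
      then show ?case using no by force
    qed (rule i)
    have "i < j"
    proof (rule ccontr)
      assume "\<not> i < j"
      then have "j = i \<or> tk j < tk i"
        using int_strict_mono[of tk, OF less, of j i] by linarith
      then show False using i j by auto
    qed
    then show False
      using le[of j] j by simp
  qed
  then show thesis using that by blast
qed

lemma has_vector_derivative_left_quotient:
  fixes f :: "real \<Rightarrow> 'a::real_normed_vector"
  assumes "(f has_vector_derivative d) (at_left b)"
  shows "((\<lambda>t. (f t - f b) /\<^sub>R (t - b)) \<longlongrightarrow> d) (at_left b)"
proof -
  have "((\<lambda>t. norm ((f t - f b) - (t - b) *\<^sub>R d) / norm (t - b)) \<longlongrightarrow> 0) (at_left b)"
    using assms unfolding has_vector_derivative_def has_derivative_iff_norm by simp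
  moreover have "eventually (\<lambda>t. t \<noteq> b) (at_left b)"
    by (simp add: eventually_at_filter)
  then have "eventually (\<lambda>t. norm ((f t - f b) - (t - b) *\<^sub>R d) / norm (t - b)
      = norm ((f t - f b) /\<^sub>R (t - b) - d)) (at_left b)"
  proof eventually_elim
    case (elim t)
    then have "(f t - f b) /\<^sub>R (t - b) - d = ((f t - f b) - (t - b) *\<^sub>R d) /\<^sub>R (t - b)"
      by (simp add: scaleR_diff_right)
    then show ?case
      by (simp add: divide_inverse_commute)
  qed
  ultimately have "((\<lambda>t. norm ((f t - f b) /\<^sub>R (t - b) - d)) \<longlongrightarrow> 0) (at_left b)"
    by (rule Lim_transform_eventually)
  then show ?thesis
    unfolding tendsto_norm_zero_iff by (rule LIM_zero_cancel)
qed

text \<open>The sequence \<open>z\<close> is the one read for the problem started at \<open>\<tau>\<close>, so it never lies before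
  \<open>\<tau>\<close>, and \<open>k0\<close> is the index of the interval that contains \<open>\<tau>\<close>.  Invertibility of \<open>E\<close> at the
  start of each interval is what allows the delayed value to be solved for.\<close>

locale impulsive_problem =
  fixes tk z :: "int \<Rightarrow> real"
    and A B :: "real \<Rightarrow> real^'n^'n"
    and F :: "real \<Rightarrow> real^'n"
    and C :: "int \<Rightarrow> real^'n^'n"
    and D :: "int \<Rightarrow> real^'n"
    and \<Phi> :: "real \<Rightarrow> real \<Rightarrow> real^'n^'n"
    and \<tau> :: real
    and k0 :: int
  assumes tk_less: "\<And>k. tk k < tk (k + 1)"
    and contA: "continuous_on UNIV A" and contB: "continuous_on UNIV B"
    and contF: "continuous_on UNIV F" and Phi: "transition_matrix A \<Phi>"
    and tau: "tk k0 \<le> \<tau>" "\<tau> < tk (k0 + 1)"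
    and z_in: "\<And>k. k0 \<le> k \<Longrightarrow> z k \<in> {max \<tau> (tk k)..tk (k + 1)}"
    and invE: "\<And>k. k0 \<le> k \<Longrightarrow> invertible (E_mat \<Phi> B (max \<tau> (tk k)) (z k))"
begin

definition start :: "int \<Rightarrow> real" where "start k = max \<tau> (tk k)"

abbreviation propagator :: "int \<Rightarrow> real \<Rightarrow> real^'n^'n" where
  "propagator k t \<equiv> piece_propagator \<Phi> B (z k) (start k) t"

abbreviation forced :: "int \<Rightarrow> real \<Rightarrow> real^'n" where
  "forced k t \<equiv> forced_part \<Phi> F (z k) t"

abbreviation sol :: "int \<Rightarrow> real^'n \<Rightarrow> real \<Rightarrow> real^'n" where
  "sol k x t \<equiv> piece_solution \<Phi> B F (z k) (start k) x t"

lemma tk_mono: "i < j \<Longrightarrow> tk i < tk j"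
  using int_strict_mono[of tk, OF tk_less] .

lemma start_k0: "start k0 = \<tau>"
  using tau by (simp add: start_def)

lemma start_later: "k0 < k \<Longrightarrow> start k = tk k"
  using tau tk_mono[of "k0 + 1" k] by (cases "k = k0 + 1") (auto simp: start_def)

lemma start_in_piece:
  assumes "k0 \<le> k"
  shows "tk k \<le> start k" "start k < tk (k + 1)" "\<tau> \<le> start k"
  using assms tau tk_less[of k] start_k0 start_later[of k]
  by (cases "k = k0"; auto simp: start_def)+

lemma index_in_piece:
  assumes "k0 \<le> k" "t \<in> {start k..<tk (k + 1)}"
  shows "interval_index tk t = k"
  using assms start_in_piece[of k] by (intro interval_index_eqI tk_less) auto

lemma index_tau: "interval_index tk \<tau> = k0"
  using index_in_piece[of k0 \<tau>] tau start_k0 by simp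

lemma invE_start: "k0 \<le> k \<Longrightarrow> invertible (E_mat \<Phi> B (start k) (z k))"
  using invE by (simp add: start_def)

lemma prop_start: "k0 \<le> k \<Longrightarrow> propagator k (start k) = mat 1"
  unfolding piece_propagator_def by (rule matrix_inv_mult_right[OF invE_start])

text \<open>The left-hand limit at the end of an interval is the value there of the explicit solution,
  which is differentiable on the whole line.  This also supplies the delayed value when \<open>z\<close> is
  the right end point, and the one-sided derivative at the jump.\<close>

lemma ivp_solution_iff_recursion:
  "ivp_solution tk z A B F C D \<tau> y0 y \<longleftrightarrow>
     y \<tau> = y0 \<and>
     (\<forall>k\<ge>k0. (\<forall>t\<in>{start k..<tk (k + 1)}. y t = sol k (y (start k)) t) \<and>
        y (tk (k + 1)) = (mat 1 + C (k + 1)) *v sol k (y (start k)) (tk (k + 1)) + D (k + 1))"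
  (is "?L \<longleftrightarrow> ?R")
proof
  assume L: ?L
  have 1: "y t = sol k (y (start k)) t" if k: "k0 \<le> k" and t: "t \<in> {start k..<tk (k + 1)}" for k t
  proof (rule piece_solution_unique[OF contA contB contF Phi _ _ _ invE_start[OF k] refl _ t])
    show "start k < tk (k + 1)" "start k \<le> z k" "z k \<le> tk (k + 1)"
      using start_in_piece[OF k] z_in[OF k] by (auto simp: start_def)
    show "(y has_vector_derivative A t *v y t
        + B t *v (if z k < tk (k + 1) then y (z k) else left_limit y (tk (k + 1))) + F t)
        (at t within {start k..<tk (k + 1)})"
      if "t \<in> {start k..<tk (k + 1)}" for t
      using L k that unfolding ivp_solution_def arg_value_def index_tau start_def by blast
  qed
  have 2: "y (tk (k + 1)) = (mat 1 + C (k + 1)) *v sol k (y (start k)) (tk (k + 1)) + D (k + 1)"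
    if k: "k0 \<le> k" for k
  proof -
    have "isCont (piece_solution \<Phi> B F (z k) (start k) (y (start k))) (tk (k + 1))"
      using piece_solution_deriv[OF contA contB contF Phi] has_vector_derivative_continuous by blast
    from left_limit_eqI(2)[OF start_in_piece(2)[OF k] 1[OF k] this]
    have "left_limit y (tk (k + 1)) = sol k (y (start k)) (tk (k + 1))" .
    moreover have "y (tk (k + 1))
        = (mat 1 + C (k + 1)) *v left_limit y (tk (k + 1)) + D (k + 1)"
      using L k unfolding ivp_solution_def index_tau by (metis zle_add1_eq_le)
    ultimately show ?thesis by simp
  qed
  show ?R
    using 1 2 L unfolding ivp_solution_def by blast
next
  assume R: ?R
  define G where "G k = piece_solution \<Phi> B F (z k) (start k) (y (start k))" for k
  have yG: "y t = G k t" if "k0 \<le> k" "t \<in> {start k..<tk (k + 1)}" for k t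
    using R that unfolding G_def by blast
  have dG: "(G k has_vector_derivative A t *v G k t + B t *v G k (z k) + F t) (at t)" for k t
    unfolding G_def by (rule piece_solution_deriv[OF contA contB contF Phi])
  then have contG: "isCont (G k) t" for k t
    using has_vector_derivative_continuous by blast
  have lim: "(y \<longlongrightarrow> G k (tk (k + 1))) (at_left (tk (k + 1)))"
    "left_limit y (tk (k + 1)) = G k (tk (k + 1))" if k: "k0 \<le> k" for k
    using left_limit_eqI[OF start_in_piece(2)[OF k] yG[OF k] contG] by auto
  have arg: "arg_value tk z y k = G k (z k)" if k: "k0 \<le> k" for k
    using lim[OF k] yG[OF k, of "z k"] z_in[OF k] by (auto simp: arg_value_def start_def)
  have dy: "(y has_vector_derivative A t *v y t + B t *v arg_value tk z y k + F t)
      (at t within {start k..<tk (k + 1)})" if k: "k0 \<le> k" and t: "t \<in> {start k..<tk (k + 1)}" for k t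
  proof (rule has_vector_derivative_transform[OF t])
    show "(G k has_vector_derivative A t *v y t + B t *v arg_value tk z y k + F t)
        (at t within {start k..<tk (k + 1)})"
      using dG by (simp add: yG[OF k t] arg[OF k] has_vector_derivative_at_within)
  qed (simp add: yG[OF k])
  have cy: "continuous_on {start k..<tk (k + 1)} y" if k: "k0 \<le> k" for k
    using dy[OF k] has_vector_derivative_continuous
    by (force simp: continuous_on_eq_continuous_within)
  have quot: "\<exists>d. ((\<lambda>t. (y t - left_limit y (tk (k + 1))) /\<^sub>R (t - tk (k + 1))) \<longlongrightarrow> d)
      (at_left (tk (k + 1)))" if k: "k0 \<le> k" for k
  proof -
    let ?b = "tk (k + 1)"
    have "(G k has_vector_derivative A ?b *v G k ?b + B ?b *v G k (z k) + F ?b) (at_left ?b)"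
      using dG by (rule has_vector_derivative_at_within)
    then have "((\<lambda>t. (G k t - G k ?b) /\<^sub>R (t - ?b)) \<longlongrightarrow> A ?b *v G k ?b + B ?b *v G k (z k) + F ?b)
        (at_left ?b)"
      by (rule has_vector_derivative_left_quotient)
    moreover have "eventually (\<lambda>t. t \<in> {start k<..<?b}) (at_left ?b)"
      using start_in_piece(2)[OF k] by (rule eventually_at_leftI[rotated]) simp
    then have "eventually (\<lambda>t. (G k t - G k ?b) /\<^sub>R (t - ?b)
        = (y t - left_limit y ?b) /\<^sub>R (t - ?b)) (at_left ?b)"
      by eventually_elim (simp add: yG[OF k] lim(2)[OF k])
    ultimately show ?thesis
      by (intro exI) (rule Lim_transform_eventually)
  qed
  have jump: "y (tk (k + 1)) = (mat 1 + C (k + 1)) *v left_limit y (tk (k + 1)) + D (k + 1)"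
    if k: "k0 \<le> k" for k
    using R k lim(2)[OF k] by (simp add: G_def)
  have lim_ex: "\<exists>l. (y \<longlongrightarrow> l) (at_left (tk (k + 1)))" if k: "k0 \<le> k" for k
    using lim(1)[OF k] by (rule exI)
  have "(\<exists>l. (y \<longlongrightarrow> l) (at_left (tk k))) \<and>
        (\<exists>d. ((\<lambda>t. (y t - left_limit y (tk k)) /\<^sub>R (t - tk k)) \<longlongrightarrow> d) (at_left (tk k))) \<and>
        y (tk k) = (mat 1 + C k) *v left_limit y (tk k) + D k" if k: "k0 < k" for k
  proof -
    obtain j where j: "k = j + 1" "k0 \<le> j"
      using k by (metis add_le_cancel_right add1_zle_eq diff_add_cancel)
    show ?thesis
      unfolding j(1) by (intro conjI lim_ex quot jump j(2))
  qed
  then have jumps: "\<forall>k>k0. (\<exists>l. (y \<longlongrightarrow> l) (at_left (tk k))) \<and>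
        (\<exists>d. ((\<lambda>t. (y t - left_limit y (tk k)) /\<^sub>R (t - tk k)) \<longlongrightarrow> d) (at_left (tk k))) \<and>
        y (tk k) = (mat 1 + C k) *v left_limit y (tk k) + D k"
    by simp
  have pieces: "\<forall>k\<ge>k0. continuous_on {start k..<tk (k + 1)} y \<and>
      (\<forall>t\<in>{start k..<tk (k + 1)}.
        (y has_vector_derivative A t *v y t + B t *v arg_value tk z y k + F t)
          (at t within {start k..<tk (k + 1)}))"
    using cy dy by simp
  show ?L
    unfolding ivp_solution_def index_tau start_def[symmetric]
    by (intro conjI pieces jumps) (use R in simp)
qed

text \<open>The factor that carries data from the start of interval \<open>r\<close> to the start of interval \<open>k\<close>;
  the matrix \<open>W\<close> is the product of this factor with the propagator inside the last interval.\<close>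

definition transfer :: "int \<Rightarrow> int \<Rightarrow> real^'n^'n" where
  "transfer k r =
     (if k = r then mat 1
      else left_prod (\<lambda>j. (mat 1 + C (j + 1)) ** E_mat \<Phi> B (tk (j + 1)) (z j)
             ** matrix_inv (E_mat \<Phi> B (tk j) (z j))) (r + 1) (k - 1)
           ** ((mat 1 + C (r + 1)) ** propagator r (tk (r + 1))))"

lemma transfer_step:
  assumes "k0 \<le> r" "r \<le> k"
  shows "transfer (k + 1) r = (mat 1 + C (k + 1)) ** propagator k (tk (k + 1)) ** transfer k r"
proof (cases "k = r")
  case True
  then show ?thesis by (simp add: transfer_def left_prod_empty)
next
  case False
  then show ?thesis
    using assms start_later[of k]
    by (simp add: transfer_def left_prod_step piece_propagator_def matrix_mul_assoc)
qed

lemma W_mat_eq: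
  assumes r: "k0 \<le> r" "r \<le> k" and t: "t \<in> {start k..<tk (k + 1)}"
  shows "W_mat tk z \<Phi> B C t (start r) = propagator k t ** transfer k r"
proof -
  have kt: "interval_index tk t = k" and kr: "interval_index tk (start r) = r"
    using index_in_piece r t start_in_piece[OF r(1)] by auto
  show ?thesis
    using r start_later[of k]
    by (auto simp: W_mat_def Let_def pc_arg_def kt kr transfer_def piece_propagator_def
        matrix_mul_assoc)
qed

text \<open>The data that enter at the start of interval \<open>r\<close>: the impulse, the forcing accumulated
  after \<open>z (r - 1)\<close> and carried through the jump, and the forcing up to \<open>z r\<close>.  On the initial
  interval the initial value takes the place of the first two.\<close>

definition source :: "real^'n \<Rightarrow> int \<Rightarrow> real^'n" where
  "source y0 r =
     (if r = k0 then y0 else (mat 1 + C r) *v forced (r - 1) (tk r) + D r) - forced r (start r)"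

text \<open>The homogeneous part \<open>y (start k) - forced k (start k)\<close> of the value at the start of
  interval \<open>k\<close>, as a superposition of all data that entered up to then.\<close>

definition state :: "real^'n \<Rightarrow> int \<Rightarrow> real^'n" where
  "state y0 k = (\<Sum>r = k0..k. transfer k r *v source y0 r)"

lemma state_k0: "state y0 k0 = y0 - forced k0 \<tau>"
  by (simp add: state_def source_def transfer_def start_k0)

lemma atLeastAtMost_int_step: "a \<le> k + 1 \<Longrightarrow> {a..k + 1} = insert (k + 1) {a..k}" for a k :: int
  by auto

lemma state_step:
  assumes k: "k0 \<le> k"
  shows "state y0 (k + 1) = (mat 1 + C (k + 1)) *v
      (propagator k (tk (k + 1)) *v state y0 k + forced k (tk (k + 1)))
      + D (k + 1) - forced (k + 1) (tk (k + 1))"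
proof -
  let ?M = "(mat 1 + C (k + 1)) ** propagator k (tk (k + 1))"
  have "(\<Sum>r = k0..k. transfer (k + 1) r *v source y0 r) = ?M *v state y0 k"
    unfolding state_def linear_sum[OF matrix_vector_mul_linear]
    by (intro sum.cong refl) (simp add: transfer_step matrix_vector_mul_assoc)
  moreover have "state y0 (k + 1) = transfer (k + 1) (k + 1) *v source y0 (k + 1)
      + (\<Sum>r = k0..k. transfer (k + 1) r *v source y0 r)"
    using k by (simp add: state_def atLeastAtMost_int_step)
  ultimately have "state y0 (k + 1) = source y0 (k + 1) + ?M *v state y0 k"
    by (simp add: transfer_def)
  then show ?thesis
    using k start_later[of "k + 1"]
    by (simp add: source_def matrix_vector_right_distrib matrix_vector_mul_assoc)
qed

lemma recursion_iff_closed_form: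
  "(y \<tau> = y0 \<and>
     (\<forall>k\<ge>k0. (\<forall>t\<in>{start k..<tk (k + 1)}. y t = sol k (y (start k)) t) \<and>
        y (tk (k + 1)) = (mat 1 + C (k + 1)) *v sol k (y (start k)) (tk (k + 1)) + D (k + 1)))
   \<longleftrightarrow> (\<forall>k\<ge>k0. \<forall>t\<in>{start k..<tk (k + 1)}. y t = propagator k t *v state y0 k + forced k t)"
  (is "?L \<longleftrightarrow> ?R")
proof
  assume L: ?L
  have start: "y (start k) - forced k (start k) = state y0 k" if "k0 \<le> k" for k
    using that
  proof (induction k rule: int_ge_induct)
    case base
    then show ?case using L by (simp add: state_k0 start_k0)
  next
    case (step k)
    then show ?case
      using L start_later[of "k + 1"] by (simp add: state_step piece_solution_def)
  qed
  show ?R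
    using L start by (metis piece_solution_def)
next
  assume R: ?R
  have start: "y (start k) = state y0 k + forced k (start k)" if "k0 \<le> k" for k
    using R that start_in_piece[OF that] prop_start[OF that] by simp
  have sol: "sol k (y (start k)) t = propagator k t *v state y0 k + forced k t" if "k0 \<le> k" for k t
    by (simp add: piece_solution_def start[OF that])
  have "y \<tau> = y0"
    using start[of k0] by (simp add: start_k0 state_k0)
  moreover have "y (tk (k + 1))
      = (mat 1 + C (k + 1)) *v sol k (y (start k)) (tk (k + 1)) + D (k + 1)" if "k0 \<le> k" for k
    using start[of "k + 1"] start_later[of "k + 1"] that by (simp add: sol state_step)
  moreover have "y t = sol k (y (start k)) t" if "k0 \<le> k" "t \<in> {start k..<tk (k + 1)}" for k t
    using R sol[OF that(1)] that by simp
  ultimately show ?L by blast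
qed

lemma LBINT_matrix_transition:
  fixes a b :: real
  shows "(LBINT s=a..b. (M ** \<Phi> t s) *v F s) = M *v (LBINT s=a..b. \<Phi> t s *v F s)"
  using LBINT_bounded_linear[OF continuous_on_transition_matrix_mult[OF contA Phi contF, of t]
      bounded_linear_matrix_vector_mult_right[of M], where a = a and b = b]
  by (simp add: matrix_vector_mul_assoc)

lemma LBINT_matrix_forced:
  "(LBINT s=z r..b. (M ** \<Phi> b s) *v F s) = M *v forced r b"
  "(LBINT s=b..z r. (M ** \<Phi> b s) *v F s) = - (M *v forced r b)"
  unfolding LBINT_matrix_transition forced_part_def interval_integral_endpoints_reverse[of b "z r"]
  by (simp_all add: linear_neg[OF matrix_vector_mul_linear])

lemma variation_of_parameters_closed_form:
  fixes W
  assumes k: "k0 \<le> k" and t: "t \<in> {start k..<tk (k + 1)}"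
  defines "W \<equiv> W_mat tk z \<Phi> B C"
  shows "W t \<tau> *v y0
      + (LBINT s=\<tau>..z k0. (W t \<tau> ** \<Phi> \<tau> s) *v F s)
      + (\<Sum>r = k0 + 1..k. LBINT s=tk r..z r. (W t (tk r) ** \<Phi> (tk r) s) *v F s)
      + (\<Sum>r = k0..k - 1. LBINT s=z r..tk (r + 1).
           (W t (tk (r + 1)) ** (mat 1 + C (r + 1)) ** \<Phi> (tk (r + 1)) s) *v F s)
      + (LBINT s=z k..t. \<Phi> t s *v F s)
      + (\<Sum>r = k0 + 1..k. W t (tk r) *v D r)
    = propagator k t *v state y0 k + forced k t"
proof -
  let ?S = "{k0 + 1..k}"
  have later: "start r = tk r" if "r \<in> ?S" for r
    using that start_later by simp
  have shift: "(\<Sum>r = k0..k - 1. f (r + 1)) = (\<Sum>r\<in>?S. f r)" for f :: "int \<Rightarrow> real^'n"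
    by (rule sum.reindex_bij_witness[where i = "\<lambda>r. r - 1" and j = "\<lambda>r. r + 1"]) auto
  have "propagator k t *v state y0 k = (\<Sum>r = k0..k. W t (start r) *v source y0 r)"
    unfolding state_def linear_sum[OF matrix_vector_mul_linear] W_def
    by (intro sum.cong refl) (simp add: W_mat_eq[OF _ _ t] matrix_vector_mul_assoc)
  also have "\<dots> = W t \<tau> *v source y0 k0 + (\<Sum>r\<in>?S. W t (start r) *v source y0 r)"
  proof -
    have "{k0..k} = insert k0 ?S" using k by auto
    then show ?thesis by (simp add: start_k0)
  qed
  also have "(\<Sum>r\<in>?S. W t (start r) *v source y0 r)
      = (\<Sum>r\<in>?S. - (W t (tk r) *v forced r (tk r)))
        + (\<Sum>r\<in>?S. (W t (tk r) ** (mat 1 + C r)) *v forced (r - 1) (tk r))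
        + (\<Sum>r\<in>?S. W t (tk r) *v D r)"
    unfolding sum.distrib[symmetric]
    by (intro sum.cong refl)
      (simp add: later source_def matrix_vector_right_distrib matrix_vector_mult_diff_distrib
        flip: matrix_vector_mul_assoc)
  also have "(\<Sum>r\<in>?S. (W t (tk r) ** (mat 1 + C r)) *v forced (r - 1) (tk r))
      = (\<Sum>r = k0..k - 1. (W t (tk (r + 1)) ** (mat 1 + C (r + 1))) *v forced r (tk (r + 1)))"
    using shift[of "\<lambda>r. (W t (tk r) ** (mat 1 + C r)) *v forced (r - 1) (tk r)"] by simp
  also have "W t \<tau> *v source y0 k0 = W t \<tau> *v y0 + - (W t \<tau> *v forced k0 \<tau>)"
    by (simp add: source_def start_k0 matrix_vector_mult_diff_distrib)
  finally show ?thesis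
    by (simp only: LBINT_matrix_forced forced_part_def[of \<Phi> F "z k" t] ac_simps)
qed

lemma piece_cases:
  assumes top: "filterlim tk at_top at_top" and bot: "filterlim tk at_bot at_bot"
    and t: "\<tau> \<le> t"
  obtains k where "k0 \<le> k" "t \<in> {start k..<tk (k + 1)}" "interval_index tk t = k"
proof -
  obtain k where k: "tk k \<le> t" "t < tk (k + 1)"
    using interval_index_exists[OF tk_less top bot] .
  have "k0 \<le> k"
  proof (rule ccontr)
    assume "\<not> k0 \<le> k"
    then have "k + 1 = k0 \<or> tk (k + 1) < tk k0"
      using tk_mono[of "k + 1" k0] by linarith
    then show False using k t tau by auto
  qed
  moreover have "t \<in> {start k..<tk (k + 1)}"
    using k t by (simp add: start_def)
  ultimately show thesis
    using that index_in_piece by blast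
qed

end

section \<open>The variation of parameters formula\<close>

theorem mainTheorem1:
  fixes tk \<zeta> :: "int \<Rightarrow> real"
    and A B :: "real \<Rightarrow> real^'n^'n"
    and F :: "real \<Rightarrow> real^'n"
    and C :: "int \<Rightarrow> real^'n^'n"
    and D :: "int \<Rightarrow> real^'n"
    and \<Phi> :: "real \<Rightarrow> real \<Rightarrow> real^'n^'n"
    and N :: "real^'n^'n \<Rightarrow> real"
    and \<tau> :: real
    and y0 :: "real^'n"
    and y :: "real \<Rightarrow> real^'n"
  assumes tk_less: "\<And>k. tk k < tk (k + 1)"
    and tk_top: "filterlim tk at_top at_top"
    and tk_bot: "filterlim tk at_bot at_bot"
    and zeta_in: "\<And>k. \<zeta> k \<in> {tk k..tk (k + 1)}"
    and contA: "continuous_on UNIV A"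
    and contB: "continuous_on UNIV B"
    and contF: "continuous_on UNIV F"
    and invC: "\<And>k. invertible (mat 1 + C k)"
    and Phi: "transition_matrix A \<Phi>"
    and norm: "matrix_norm N"
    and rho_bdd: "bdd_above (range (rho N tk \<zeta> A))"
    and nu_plus_bdd: "bdd_above (range (nu_plus N tk \<zeta> A B))"
    and nu_plus_less: "(SUP k. nu_plus N tk \<zeta> A B k) < 1"
    and nu_minus_bdd: "bdd_above (range (nu_minus N tk \<zeta> A B))"
    and nu_minus_less: "(SUP k. nu_minus N tk \<zeta> A B k) < 1"
    and J_init: "invertible (J_mat \<Phi> B \<tau> (pc_arg tk (zeta_from tk \<zeta> \<tau>) \<tau>))"
  shows "let k = interval_index tk;
             z = zeta_from tk \<zeta> \<tau>;
             W = W_mat tk z \<Phi> B C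
         in ivp_solution tk z A B F C D \<tau> y0 y \<longleftrightarrow>
            (\<forall>t\<ge>\<tau>. y t =
                W t \<tau> *v y0
              + (LBINT s=\<tau>..z (k \<tau>). (W t \<tau> ** \<Phi> \<tau> s) *v F s)
              + (\<Sum>r = k \<tau> + 1..k t. LBINT s=tk r..z r. (W t (tk r) ** \<Phi> (tk r) s) *v F s)
              + (\<Sum>r = k \<tau>..k t - 1. LBINT s=z r..tk (r + 1).
                   (W t (tk (r + 1)) ** (mat 1 + C (r + 1)) ** \<Phi> (tk (r + 1)) s) *v F s)
              + (LBINT s=z (k t)..t. \<Phi> t s *v F s)
              + (\<Sum>r = k \<tau> + 1..k t. W t (tk r) *v D r))"
proof -
  define k0 where "k0 = interval_index tk \<tau>"
  define z where "z = zeta_from tk \<zeta> \<tau>"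
  obtain j where "tk j \<le> \<tau>" "\<tau> < tk (j + 1)"
    using interval_index_exists[OF tk_less tk_top tk_bot] .
  then have tau: "tk k0 \<le> \<tau>" "\<tau> < tk (k0 + 1)"
    using interval_index_eqI[of tk, OF tk_less] by (simp_all add: k0_def)
  have later: "\<tau> < tk k" if "k0 < k" for k
    using tau int_strict_mono[of tk, OF tk_less, of "k0 + 1" k] that
    by (cases "k = k0 + 1") auto
  have z_later: "z k = \<zeta> k" if "k0 < k" for k
    using that by (simp add: z_def zeta_from_def k0_def)
  have small: "exp (LBINT u=tk k..\<zeta> k. N (A u)) * (LBINT u=tk k..\<zeta> k. N (B u)) < 1" for k
    using cSUP_upper[OF UNIV_I nu_plus_bdd, of k] nu_plus_less
    by (simp add: nu_plus_def rho_plus_def)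
  interpret impulsive_problem tk z A B F C D \<Phi> \<tau> k0
  proof
    fix k assume k: "k0 \<le> k"
    show "z k \<in> {max \<tau> (tk k)..tk (k + 1)}"
    proof (cases "k = k0")
      case True
      then show ?thesis
        using tau zeta_in[of k0] by (auto simp: z_def zeta_from_def k0_def)
    next
      case False
      then show ?thesis
        using k later[of k] z_later[of k] zeta_in[of k] by simp
    qed
    have "invertible (J_mat \<Phi> B (max \<tau> (tk k)) (z k))"
    proof (cases "k = k0")
      case True
      then show ?thesis
        using J_init tau by (simp add: pc_arg_def z_def k0_def max_absorb1)
    next
      case False
      then have "invertible (J_mat \<Phi> B (tk k) (\<zeta> k))"
        using zeta_in[of k] small by (intro invertible_J_mat[OF contA Phi contB norm]) auto
      then show ?thesis
        using False k later[of k] z_later[of k] by simp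
    qed
    then show "invertible (E_mat \<Phi> B (max \<tau> (tk k)) (z k))"
      by (simp add: invertible_E_mat_iff[OF contA contB contF Phi])
  qed (fact tk_less contA contB contF Phi tau)+
  have by_pieces: "(\<forall>t\<ge>\<tau>. Q t) \<longleftrightarrow> (\<forall>k\<ge>k0. \<forall>t\<in>{start k..<tk (k + 1)}. Q t)" for Q
  proof
    assume "\<forall>t\<ge>\<tau>. Q t"
    then show "\<forall>k\<ge>k0. \<forall>t\<in>{start k..<tk (k + 1)}. Q t"
      using start_in_piece(3) by fastforce
  next
    assume "\<forall>k\<ge>k0. \<forall>t\<in>{start k..<tk (k + 1)}. Q t"
    then show "\<forall>t\<ge>\<tau>. Q t"
      using piece_cases[OF tk_top tk_bot] by metis
  qed
  show ?thesis
    unfolding Let_def z_def[symmetric] k0_def[symmetric] by_pieces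
      ivp_solution_iff_recursion recursion_iff_closed_form
    apply (intro all_cong1 imp_cong ball_cong refl)
    subgoal premises p for k t
      by (simp only: index_in_piece[OF p] variation_of_parameters_closed_form[OF p])
    done
qed

end
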